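(* The eager Boston mechanism (EBM), regarded as the random mechanism $R\mapsto \mathbb E(\mathrm{EBM}(R))$, satisfies ex-post favoring-eagerness-for-remaining-items (ep-FERI), sd-weak-envy-freeness (sd-WEF), strong equal treatment of equals (SETE), and sd-weak-strategyproofness (sd-WSP).
   Context: Setting. An assignment problem has a set $N=\{1,\dots,n\}$ of agents and a set $M$ of $n$ items (one unit each). A preference profile $R=(\succ_j)_{j\in N}$ gives each agent $j$ a strict linear order $\succ_j$ on $M$. For nonempty $S\subseteq M$, $\mathrm{top}(j,S)$ is the $\succ_j$-best item of $S$; $rk(j,o)\in\{1,\dots,n\}$ is the rank of $o$ in $\succ_j$ ($1$ = best). A random assignment is a doubly stochastic $n\times n$ matrix $P=[p_{j,o}]_{j\in N,o\in M}$, with $j$-th row $P_j$. A deterministic assignment is a bijection $A:N\to M$, identified with its permutation matrix. A mechanism $f$ maps preference profiles to random assignments, and satisfies a property of random assignments if $f(R)$ satisfies it for every $R$. EBM. Start with $M'=M$, $N'=N$. While $M'\neq\emptyset$, perform a round: for each $o\in M'$ let $N_o=\{j\in N': \mathrm{top}(j,M')=o\}$; for each $o\in M'$ with $N_o\ne\emptyset$ draw an agent $j_o\in N_o$ uniformly at random (independently of all other draws) and allocate $o$ to $j_o$; then remove from $M'$ all items $o$ with $N_o\neq\emptyset$ and remove from $N'$ all the corresponding winners $j_o$. The resulting deterministic assignment is $\mathrm{EBM}(R)$ (a random variable), and $\mathbb E(\mathrm{EBM}(R))$ is its expected permutation matrix, i.e. the matrix whose $(j,o)$ entry is the probability that $j$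 gets $o$. FERI. For a deterministic assignment $A$ define recursively for $r=1,2,\dots$: $T_{A,r}=\{o\in M: o=\mathrm{top}(j,M\setminus\bigcup_{r'<r}T_{A,r'})\text{ for some }j\in N\text{ with }A(j)\notin\bigcup_{r'<r}T_{A,r'}\}$. $A$ satisfies FERI if for every $r\ge 1$ and every $o\in T_{A,r}$, $o=\mathrm{top}(A^{-1}(o),M\setminus\bigcup_{r'<r}T_{A,r'})$. A random assignment satisfies ep-FERI if it is a convex combination of deterministic assignments satisfying FERI. Stochastic dominance. For a linear order $\succ$ on $M$ let $U(\succ,o)=\{o'\in M: o'\succ o\}\cup\{o\}$. For probability vectors $p,q$ on $M$, $p\succeq^{sd}_j q$ means $\sum_{o'\in U(\succ_j,o)}p_{o'}\ge\sum_{o'\in U(\succ_j,o)}q_{o'}$ for all $o\in M$. sd-WEF: a random assignment $P$ is sd-WEF if for all $j,k\in N$, $P_k\succeq^{sd}_jP_j$ implies $P_j=P_k$. SETE: for agents $j,k$, their common prefix is the set $M'\subseteq M$ such that $rk(j,o)=rk(k,o)\le |M'|$ for all $o\in M'$ and $\mathrm{top}(j,M\setminus M')\ne\mathrm{top}(k,M\setminus M')$ (with $M'=M$ if $\succ_j=\succ_k$). $P$ satisfies SETE if $p_{j,o}=p_{k,o}$ for all $j,k\in N$ and all $o$ in the common prefix of $j$ and $k$. sd-WSP: a mechanism $f$ is sd-WSP if for every profile $R$, every $j\in N$ and every profile $R'=(\succ'_j,\succ_{-j})$ obtained from $R$ by changing only $j$'s preference, $f(R')_j\succeq^{sd}_jf(R)_j$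 (with respect to $\succ_j$) implies $f(R')_j=f(R)_j$. *)

theory Defs
  imports "HOL-Probability.Product_PMF"
begin

text \<open>
  Agents are the elements of a finite type \<open>'a\<close> and items those of a finite type \<open>'b\<close>
  (of equal cardinality \<open>n\<close>, which is assumed where it is needed).  A preference is a strict
  linear order \<open>r\<close> in which \<open>(x, y) \<in> r\<close> means that \<open>x\<close> is strictly better than \<open>y\<close>.
\<close>

type_synonym ('a, 'b) profile = "'a \<Rightarrow> 'b rel"
type_synonym ('a, 'b) mechanism = "('a, 'b) profile \<Rightarrow> real^'b^'a"

definition profile :: "('a, 'b) profile \<Rightarrow> bool" where
  "profile R \<longleftrightarrow> (\<forall>j. strict_linear_order (R j))"

definition top_item :: "'b rel \<Rightarrow> 'b set \<Rightarrow> 'b" where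
  "top_item r S = (THE x. x \<in> S \<and> (\<forall>y\<in>S. y \<noteq> x \<longrightarrow> (x, y) \<in> r))"

definition upper_set :: "'b rel \<Rightarrow> 'b \<Rightarrow> 'b set" where
  "upper_set r x = {y. (y, x) \<in> r} \<union> {x}"

definition rk :: "'b rel \<Rightarrow> 'b \<Rightarrow> nat" where
  "rk r x = card (upper_set r x)"

definition random_assignment :: "real^('b::finite)^('a::finite) \<Rightarrow> bool" where
  "random_assignment P \<longleftrightarrow>
     (\<forall>j x. 0 \<le> P $ j $ x) \<and> (\<forall>j. (\<Sum>x\<in>UNIV. P $ j $ x) = 1) \<and> (\<forall>x. (\<Sum>j\<in>UNIV. P $ j $ x) = 1)"

definition perm_matrix :: "('a \<Rightarrow> 'b) \<Rightarrow> real^('b::finite)^('a::finite)" where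
  "perm_matrix A = (\<chi> j x. if A j = x then 1 else 0)"

definition mechanism :: "('a::finite, 'b::finite) mechanism \<Rightarrow> bool" where
  "mechanism f \<longleftrightarrow> (\<forall>R. profile R \<longrightarrow> random_assignment (f R))"

definition satisfies ::
  "('a::finite, 'b::finite) mechanism \<Rightarrow> (('a, 'b) profile \<Rightarrow> real^'b^'a \<Rightarrow> bool) \<Rightarrow> bool" where
  "satisfies f Q \<longleftrightarrow> (\<forall>R. profile R \<longrightarrow> Q R (f R))"


subsection \<open>The eager Boston mechanism\<close>

definition applicants :: "('a, 'b) profile \<Rightarrow> 'a set \<Rightarrow> 'b set \<Rightarrow> 'b \<Rightarrow> 'a set" where
  "applicants R N' M' x = {j \<in> N'. top_item (R j) M' = x}"

definition requested :: "('a, 'b) profile \<Rightarrow> 'a set \<Rightarrow> 'b set \<Rightarrow> 'b set" where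
  "requested R N' M' = {x \<in> M'. applicants R N' M' x \<noteq> {}}"

lemma top_item_in:
  fixes r :: "('b::finite) rel"
  assumes "strict_linear_order r" and "S \<noteq> {}"
  shows "top_item r S \<in> S \<and> (\<forall>y\<in>S. y \<noteq> top_item r S \<longrightarrow> (top_item r S, y) \<in> r)"
proof -
  have tr: "trans r" and ir: "irrefl r" and tot: "total r"
    using assms(1) by (auto simp: strict_linear_order_on_def)
  have "acyclic r"
    using tr ir by (simp add: acyclic_irrefl)
  then have "wf r"
    by (intro finite_acyclic_wf) simp_all
  then obtain x where x: "x \<in> S" "\<And>y. (y, x) \<in> r \<Longrightarrow> y \<notin> S"
    using assms(2) by (meson ex_in_conv wfE_min)
  have best: "x \<in> S \<and> (\<forall>y\<in>S. y \<noteq> x \<longrightarrow> (x, y) \<in> r)"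
    using x tot unfolding total_on_def by blast
  have unique: "z = x" if "z \<in> S \<and> (\<forall>y\<in>S. y \<noteq> z \<longrightarrow> (z, y) \<in> r)" for z
  proof (rule ccontr)
    assume "z \<noteq> x"
    then have "(z, x) \<in> r"
      using that x(1) by (metis (no_types))
    then show False
      using that x(2) by blast
  qed
  show ?thesis
    unfolding top_item_def by (rule theI) (fact best, fact unique)
qed

text \<open>
  The loop below stops when no remaining item is requested.  As long as the remaining agents and
  items are equinumerous, this is the condition that no item is left:
\<close>

lemma requested_empty_iff:
  fixes R :: "('a::finite, 'b::finite) profile"
  assumes "profile R" and "card N' = card M'"
  shows "requested R N' M' = {} \<longleftrightarrow> M' = {}"
proof
  assume req: "requested R N' M' = {}"
  show "M' = {}"
  proof (rule ccontr)
    assume ne: "M' \<noteq> {}"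
    then obtain j where j: "j \<in> N'"
      using assms(2) by (metis all_not_in_conv card_eq_0_iff finite)
    have "top_item (R j) M' \<in> M'"
      using assms(1) ne by (auto simp: profile_def dest: top_item_in)
    then show False
      using req j by (auto simp: requested_def applicants_def)
  qed
qed (auto simp: requested_def)

text \<open>
  The argument \<open>A\<close> records the allocation made so far.  The map \<open>w\<close> sends each requested item
  to its winner.
\<close>

function ebm_loop ::
  "('a::finite, 'b::finite) profile \<Rightarrow> 'a set \<Rightarrow> 'b set \<Rightarrow> ('a \<rightharpoonup> 'b) \<Rightarrow> ('a \<rightharpoonup> 'b) pmf" where
  "ebm_loop R N' M' A =
     (if requested R N' M' = {} then return_pmf A
      else bind_pmf
        (Pi_pmf (requested R N' M') undefined (\<lambda>x. pmf_of_set (applicants R N' M' x)))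
        (\<lambda>w. ebm_loop R (N' - w ` requested R N' M') (M' - requested R N' M')
               (\<lambda>j. if j \<in> w ` requested R N' M'
                    then Some (inv_into (requested R N' M') w j) else A j)))"
  by pat_completeness auto
termination
proof (relation "Wellfounded.measure (\<lambda>(R, N', M', A). card M')")
  show "((R, N' - w ` requested R N' M', M' - requested R N' M',
           \<lambda>j. if j \<in> w ` requested R N' M'
               then Some (inv_into (requested R N' M') w j) else A j), (R, N', M', A))
         \<in> Wellfounded.measure (\<lambda>(R, N', M', A). card M')"
    if "requested R N' M' \<noteq> {}"
    for R :: "('a, 'b) profile" and N' M' A and w :: "'b \<Rightarrow> 'a"
  proof -
    have "M' - requested R N' M' \<subset> M'"
      using that by (auto simp: requested_def)
    then show ?thesis
      by (auto intro: psubset_card_mono)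
  qed
qed simp

declare ebm_loop.simps [simp del]

definition EBM :: "('a::finite, 'b::finite) profile \<Rightarrow> ('a \<Rightarrow> 'b) pmf" where
  "EBM R = map_pmf (\<lambda>A j. the (A j)) (ebm_loop R UNIV UNIV Map.empty)"

definition expected_EBM :: "('a::finite, 'b::finite) mechanism" where
  "expected_EBM R = (\<chi> j x. measure_pmf.prob (EBM R) {A. A j = x})"


subsection \<open>Favoring eagerness for remaining items\<close>

text \<open>The sets \<open>T\<^bsub>A,r\<^esub>\<close> are indexed from \<open>r = 1\<close>; the value at \<open>r = 0\<close> is never used.\<close>

function feri_T :: "('a, 'b) profile \<Rightarrow> ('a \<Rightarrow> 'b) \<Rightarrow> nat \<Rightarrow> 'b set" where
  "feri_T R A r =
     {x. \<exists>j. A j \<notin> (\<Union>r'\<in>{1..<r}. feri_T R A r') \<and>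
             x = top_item (R j) (UNIV - (\<Union>r'\<in>{1..<r}. feri_T R A r'))}"
  by pat_completeness auto
termination
  by (relation "Wellfounded.measure (\<lambda>(R, A, r). r)") auto

declare feri_T.simps [simp del]

definition FERI :: "('a, 'b) profile \<Rightarrow> ('a \<Rightarrow> 'b) \<Rightarrow> bool" where
  "FERI R A \<longleftrightarrow>
     (\<forall>r\<ge>1. \<forall>x\<in>feri_T R A r.
        x = top_item (R (inv A x)) (UNIV - (\<Union>r'\<in>{1..<r}. feri_T R A r')))"

definition ep_FERI :: "('a::finite, 'b::finite) profile \<Rightarrow> real^'b^'a \<Rightarrow> bool" where
  "ep_FERI R P \<longleftrightarrow> P \<in> convex hull {perm_matrix A |A. bij A \<and> FERI R A}"


subsection \<open>Fairness and strategyproofness\<close>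

definition sd_ge :: "'b rel \<Rightarrow> real^('b::finite) \<Rightarrow> real^'b \<Rightarrow> bool" where
  "sd_ge r p q \<longleftrightarrow> (\<forall>x. (\<Sum>y\<in>upper_set r x. p $ y) \<ge> (\<Sum>y\<in>upper_set r x. q $ y))"

definition sd_WEF :: "('a::finite, 'b::finite) profile \<Rightarrow> real^'b^'a \<Rightarrow> bool" where
  "sd_WEF R P \<longleftrightarrow> (\<forall>j k. sd_ge (R j) (P $ k) (P $ j) \<longrightarrow> P $ j = P $ k)"

definition common_prefix :: "'b rel \<Rightarrow> 'b rel \<Rightarrow> 'b set \<Rightarrow> bool" where
  "common_prefix r s M' \<longleftrightarrow>
     (if r = s then M' = UNIV
      else (\<forall>x\<in>M'. rk r x = rk s x \<and> rk r x \<le> card M') \<and>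
           top_item r (UNIV - M') \<noteq> top_item s (UNIV - M'))"

definition SETE :: "('a::finite, 'b::finite) profile \<Rightarrow> real^'b^'a \<Rightarrow> bool" where
  "SETE R P \<longleftrightarrow>
     (\<forall>j k M'. common_prefix (R j) (R k) M' \<longrightarrow> (\<forall>x\<in>M'. P $ j $ x = P $ k $ x))"

definition sd_WSP :: "('a::finite, 'b::finite) mechanism \<Rightarrow> bool" where
  "sd_WSP f \<longleftrightarrow>
     (\<forall>R j r'. profile R \<longrightarrow> profile (R(j := r')) \<longrightarrow>
        sd_ge (R j) (f (R(j := r')) $ j) (f R $ j) \<longrightarrow> f (R(j := r')) $ j = f R $ j)"

end

theory Submission
  imports Defs
begin

text \<open>
  Call a vector of differences of probabilities \<open>r\<close>-lexicographically nonnegative if it vanishes or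
  its \<open>r\<close>-best nonzero entry is positive.  These vectors form a convex cone, and a lexicographic
  comparison opposite to a stochastic dominance forces equality.  So both strategic properties
  follow from lexicographic comparisons, which are proved by induction along the rounds.  While the
  two profiles under comparison generate the same applications, a round is the same random draw on
  both sides and the cone property reduces to the next round.  When they first differ, everything
  left is at most as good for \<open>j\<close> as the item \<open>t\<close> that \<open>j\<close> applies for, so it suffices that the chance
  of \<open>t\<close> is strictly larger on one side.

  For strategyproofness, a misreporting \<open>j\<close> applies elsewhere: if \<open>t\<close> has another applicant it is
  gone, and otherwise truth-telling would have secured it, whereas the misreport wins another item
  with positive probability.  For envy, replace the preference of \<open>k\<close> by that of \<open>j\<close>.  This hurts \<open>j\<close>,
  because \<open>k\<close> joins the competition for \<open>t\<close> where the two diverged; it makes \<open>j\<close> and \<open>k\<close>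
  interchangeable; and, by the comparison for misreports, returning to the original preference of \<open>k\<close>
  can only make \<open>k\<close> worse off from the point of view of \<open>j\<close>.  Equal treatment follows from the
  same replacement, since changing preferences behind a common prefix has no effect as long as an
  item of the prefix is left.
\<close>

section \<open>The share of an agent in an intermediate state\<close>

text \<open>The distribution of one round of \<open>ebm_loop\<close>, named separately because it
  depends on the profile only through \<open>applicants\<close>: two profiles with the same
  applicants then share a literally equal draw.\<close>

definition draw :: "('a::finite, 'b::finite) profile \<Rightarrow> 'a set \<Rightarrow> 'b set \<Rightarrow> ('b \<Rightarrow> 'a) pmf" where
  "draw R N M = Pi_pmf (requested R N M) undefined (\<lambda>x. pmf_of_set (applicants R N M x))"

lemma requested_subset: "requested R N M \<subseteq> M"
  by (auto simp: requested_def)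

lemma draw_in_applicants:
  assumes "w \<in> set_pmf (draw R N M)" and "x \<in> requested R N M"
  shows "w x \<in> applicants R N M x"
  using assms by (force simp: draw_def set_Pi_pmf PiE_dflt_def requested_def)

lemma top_item_requested:
  fixes R :: "('a, 'b::finite) profile"
  assumes "profile R" and "j \<in> N" and "M \<noteq> {}"
  shows "top_item (R j) M \<in> requested R N M" and "j \<in> applicants R N M (top_item (R j) M)"
proof -
  have "top_item (R j) M \<in> M"
    using assms top_item_in[of "R j" M] by (simp add: profile_def)
  then show "top_item (R j) M \<in> requested R N M" "j \<in> applicants R N M (top_item (R j) M)"
    using assms(2) by (auto simp: requested_def applicants_def)
qed

lemma draw_winner:
  assumes "w \<in> set_pmf (draw R N M)" and "j \<in> w ` requested R N M"
  shows "j \<in> N" and "top_item (R j) M \<in> requested R N M" and "w (top_item (R j) M) = j"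
  using assms draw_in_applicants[OF assms(1)] by (force simp: applicants_def)+

lemma draw_winner_iff:
  assumes "profile R" and "j \<in> N" and "M \<noteq> {}" and "w \<in> set_pmf (draw R N M)"
  shows "j \<in> w ` requested R N M \<longleftrightarrow> w (top_item (R j) M) = j"
  using draw_winner(3)[OF assms(4)] top_item_requested(1)[OF assms(1-3)]
  by (metis image_eqI)

lemma prob_draw_winner:
  assumes "profile R" and "j \<in> N" and "M \<noteq> {}"
  shows "measure_pmf.prob (draw R N M) {w. w (top_item (R j) M) = j}
    = 1 / card (applicants R N M (top_item (R j) M))" (is "_ = 1 / card ?S")
proof -
  have j: "top_item (R j) M \<in> requested R N M" "j \<in> ?S"
    using top_item_requested[OF assms] by auto
  have "measure_pmf.prob (draw R N M) {w. w (top_item (R j) M) = j}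
      = pmf (map_pmf (\<lambda>w. w (top_item (R j) M)) (draw R N M)) j"
    by (simp add: pmf_map vimage_def)
  also have "\<dots> = 1 / card ?S"
    using j by (auto simp: draw_def Pi_pmf_component intro!: pmf_of_set[THEN trans])
  finally show ?thesis .
qed

lemma integrable_draw [simp]:
  fixes f :: "('b::finite \<Rightarrow> 'a::finite) \<Rightarrow> real"
  shows "integrable (measure_pmf (draw R N M)) f"
  by (rule integrable_measure_pmf_finite) simp

lemma expectation_draw_cong:
  fixes f g :: "('b::finite \<Rightarrow> 'a::finite) \<Rightarrow> real"
  assumes "\<And>w. w \<in> set_pmf (draw R N M) \<Longrightarrow> f w = g w"
  shows "measure_pmf.expectation (draw R N M) f = measure_pmf.expectation (draw R N M) g"
  by (intro integral_cong_AE) (auto simp: AE_measure_pmf_iff assms)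

text \<open>The probability that \<open>j\<close> obtains \<open>x\<close> when EBM continues from
  agents \<open>N\<close> and items \<open>M\<close>. As a real-valued recursion it forgets the
  partial allocation, and it makes sense for \<open>N\<close> and \<open>M\<close> of any sizes;
  \<open>prob_ebm_loop\<close> ties it to the loop.\<close>

function share ::
  "('a::finite, 'b::finite) profile \<Rightarrow> 'a set \<Rightarrow> 'b set \<Rightarrow> 'a \<Rightarrow> 'b \<Rightarrow> real" where
  "share R N M j x =
     (if requested R N M = {} then 0
      else measure_pmf.expectation (draw R N M)
        (\<lambda>w. if j \<in> w ` requested R N M then of_bool (x = top_item (R j) M)
              else share R (N - w ` requested R N M) (M - requested R N M) j x))"
  by pat_completeness auto
termination
proof (relation "Wellfounded.measure (\<lambda>(R, N, M, j, x). card M)")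
  show "((R, N - w ` requested R N M, M - requested R N M, j, x), (R, N, M, j, x))
         \<in> Wellfounded.measure (\<lambda>(R, N, M, j, x). card M)"
    if "requested R N M \<noteq> {}"
    for R :: "('a, 'b) profile" and N M and j :: 'a and x :: 'b and w :: "'b \<Rightarrow> 'a"
    using that requested_subset[of R N M] by (auto intro!: psubset_card_mono)
qed simp

declare share.simps [simp del]

text \<open>Induction along the rounds. The set \<open>N'\<close> of survivors is arbitrary, so one
  hypothesis serves all outcomes of a draw.\<close>

lemma state_induct [case_names step]:
  fixes M :: "'b::finite set"
  assumes "\<And>N M. (\<And>N' M'. requested R N M \<noteq> {} \<Longrightarrow> M' = M - requested R N M \<Longrightarrow> P N' M') \<Longrightarrow> P N M"
  shows "P N M"
proof (induction "card M" arbitrary: N M rule: less_induct)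
  case less
  show ?case
  proof (rule assms)
    fix N' M' assume "requested R N M \<noteq> {}" "M' = M - requested R N M"
    then have "card M' < card M"
      using requested_subset[of R N M] by (auto intro!: psubset_card_mono)
    then show "P N' M'"
      by (rule less)
  qed
qed

lemma share_bounds: "0 \<le> share R N M j x \<and> share R N M j x \<le> 1"
proof (induction N M rule: state_induct[where R = R])
  case (step N M)
  have "0 \<le> share R N' (M - requested R N M) j x \<and> share R N' (M - requested R N M) j x \<le> 1"
    if "requested R N M \<noteq> {}" for N'
    using step[OF that refl] .
  then show ?case
    unfolding share.simps[of R N]
    by (cases "requested R N M = {}")
      (auto intro!: integral_nonneg_AE measure_pmf.integral_le_const simp: AE_measure_pmf_iff)
qed

lemma share_outside:
  assumes "j \<notin> N \<or> x \<notin> M"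
  shows "share R N M j x = 0"
  using assms
proof (induction N M rule: state_induct[where R = R])
  case (step N M)
  have "share R (N - W) (M - requested R N M) j x = 0" if "requested R N M \<noteq> {}" for W
    using step.prems by (intro step.IH[OF that refl]) auto
  moreover have "x \<noteq> top_item (R j) M"
    if "w \<in> set_pmf (draw R N M)" "j \<in> w ` requested R N M" for w
    using draw_winner(1,2)[OF that] step.prems requested_subset[of R N M] by auto
  ultimately show ?case
    unfolding share.simps[of R N] by (simp cong: expectation_draw_cong if_cong)
qed

text \<open>As long as \<open>x\<close> is left, the remaining items meet \<open>C\<close>, so both
  profiles produce the same draw; once \<open>x\<close> is gone, both shares vanish.\<close>

lemma share_cong:
  assumes "\<And>M' i. M' \<inter> C \<noteq> {} \<Longrightarrow> i \<in> N \<Longrightarrow> top_item (R i) M' = top_item (R' i) M'" and "x \<in> C"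
  shows "share R N M j x = share R' N M j x"
  using assms(1)
proof (induction N M rule: state_induct[where R = R])
  case (step N M)
  show ?case
  proof (cases "x \<in> M")
    case True
    then have tops: "top_item (R i) M = top_item (R' i) M" if "i \<in> N" for i
      using that step.prems assms(2) by blast
    have ap: "applicants R N M = applicants R' N M"
      using tops by (auto simp: applicants_def fun_eq_iff)
    then have rq: "requested R N M = requested R' N M"
      by (simp add: requested_def)
    have dr: "draw R N M = draw R' N M"
      using ap rq by (simp add: draw_def)
    have IH: "share R (N - W) (M - requested R N M) j x = share R' (N - W) (M - requested R N M) j x"
      if "requested R N M \<noteq> {}" for W
      using step.prems by (intro step.IH[OF that refl]) auto
    have "top_item (R j) M = top_item (R' j) M"
      if "w \<in> set_pmf (draw R N M)" "j \<in> w ` requested R N M" for w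
      using draw_winner(1)[OF that] by (rule tops)
    then show ?thesis
      unfolding share.simps[of R N] share.simps[of R' N] rq[symmetric] dr[symmetric]
      by (simp add: IH cong: expectation_draw_cong if_cong)
  qed (simp add: share_outside)
qed

text \<open>The top item is requested, hence gone after this round: only the present uniform draw
  counts.\<close>

lemma share_top:
  assumes "profile R" and "j \<in> N" and "M \<noteq> {}"
  shows "share R N M j (top_item (R j) M) = 1 / card (applicants R N M (top_item (R j) M))"
proof -
  let ?Q = "requested R N M" and ?t = "top_item (R j) M"
  have "share R N M j ?t = measure_pmf.expectation (draw R N M)
      (\<lambda>w. if j \<in> w ` ?Q then of_bool (?t = ?t) else share R (N - w ` ?Q) (M - ?Q) j ?t)"
    using top_item_requested(1)[OF assms] by (subst share.simps) auto
  also have "\<dots> = measure_pmf.expectation (draw R N M) (indicator {w. w ?t = j})"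
    using top_item_requested(1)[OF assms]
    by (intro expectation_draw_cong) (simp add: draw_winner_iff[OF assms] share_outside)
  finally have "share R N M j ?t
      = measure_pmf.expectation (draw R N M) (indicator {w. w ?t = j})" .
  then show ?thesis
    using prob_draw_winner[OF assms] by simp
qed

text \<open>With positive probability \<open>j\<close> wins its top item at once and so misses
  \<open>x\<close>.\<close>

lemma share_other_lt_1:
  assumes "profile R" and "j \<in> N" and "M \<noteq> {}" and "x \<noteq> top_item (R j) M"
  shows "share R N M j x < 1"
proof -
  let ?Q = "requested R N M" and ?t = "top_item (R j) M"
  let ?S = "applicants R N M ?t"
  have "share R N M j x = measure_pmf.expectation (draw R N M)
      (\<lambda>w. if j \<in> w ` ?Q then of_bool (x = ?t) else share R (N - w ` ?Q) (M - ?Q) j x)"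
    using top_item_requested(1)[OF assms(1-3)] by (subst share.simps) auto
  \<comment> \<open>A win contributes 0 since \<open>x\<close> differs from \<open>?t\<close>; any
    continuation contributes at most 1.\<close>
  also have "\<dots> \<le> measure_pmf.expectation (draw R N M) (\<lambda>w. 1 - indicator {w. w ?t = j} w)"
    using assms(4) by (intro integral_mono_AE)
      (simp_all add: AE_measure_pmf_iff draw_winner_iff[OF assms(1-3)] share_bounds)
  also have "\<dots> = 1 - 1 / card ?S"
    using prob_draw_winner[OF assms(1-3)] by simp
  also have "\<dots> < 1"
    using top_item_requested(2)[OF assms(1-3)] by (auto simp: card_gt_0_iff)
  finally show ?thesis .
qed

section \<open>Relabelling agents that have equal preferences\<close>

lemma applicants_image:
  assumes "\<And>i. R (\<sigma> i) = R i"
  shows "applicants R (\<sigma> ` N) M x = \<sigma> ` applicants R N M x"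
  using assms by (auto simp: applicants_def)

lemma requested_image:
  assumes "\<And>i. R (\<sigma> i) = R i"
  shows "requested R (\<sigma> ` N) M = requested R N M"
  by (simp add: requested_def applicants_image[of R, OF assms])

lemma draw_image:
  assumes "\<And>i. R (\<sigma> i) = R i" and "inj \<sigma>"
  shows "draw R (\<sigma> ` N) M
    = map_pmf (\<lambda>w x. if x \<in> requested R N M then \<sigma> (w x) else undefined) (draw R N M)"
proof -
  let ?Q = "requested R N M" and ?p = "\<lambda>x. pmf_of_set (applicants R N M x)"
  have "draw R (\<sigma> ` N) M = Pi_pmf ?Q undefined (\<lambda>x. map_pmf \<sigma> (?p x))"
    unfolding draw_def requested_image[of R, OF assms(1)]
    by (intro Pi_pmf_cong refl)
      (use assms(2) in \<open>auto simp: applicants_image[of R, OF assms(1)] requested_def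
        inj_on_def map_pmf_of_set_inj\<close>)
  \<comment> \<open>\<open>\<sigma>\<close> may move the default value \<open>undefined\<close>, so
    it has to be restored outside the requested items.\<close>
  also have "\<dots> = map_pmf (\<lambda>f x. if x \<in> ?Q then f x else undefined)
      (Pi_pmf ?Q (\<sigma> undefined) (\<lambda>x. map_pmf \<sigma> (?p x)))"
    by (rule Pi_pmf_default_swap[symmetric]) simp
  also have "Pi_pmf ?Q (\<sigma> undefined) (\<lambda>x. map_pmf \<sigma> (?p x))
      = map_pmf (\<lambda>h. \<sigma> \<circ> h) (Pi_pmf ?Q undefined ?p)"
    by (rule Pi_pmf_map) auto
  finally show ?thesis
    by (simp add: draw_def map_pmf_comp comp_def cong: if_cong)
qed

text \<open>Relabelling the winners couples the two draws round by round.\<close>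

lemma share_image:
  assumes "\<And>i. R (\<sigma> i) = R i" and "inj \<sigma>"
  shows "share R (\<sigma> ` N) M (\<sigma> j) x = share R N M j x"
proof (induction N M rule: state_induct[where R = R])
  case (step N M)
  let ?Q = "requested R N M" and ?g = "\<lambda>w x. if x \<in> requested R N M then \<sigma> (w x) else undefined"
  have im: "?g w ` ?Q = \<sigma> ` w ` ?Q" for w :: "'b \<Rightarrow> 'a"
    by (auto simp: image_image)
  have mem: "\<sigma> j \<in> \<sigma> ` W \<longleftrightarrow> j \<in> W" and diff: "\<sigma> ` N - \<sigma> ` W = \<sigma> ` (N - W)" for W
    using assms(2) by (auto simp: inj_image_mem_iff image_set_diff)
  have IH: "share R (\<sigma> ` N') (M - ?Q) (\<sigma> j) x = share R N' (M - ?Q) j x" if "?Q \<noteq> {}" for N'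
    using step[OF that refl] .
  show ?case
    unfolding share.simps[of R "\<sigma> ` N"] share.simps[of R N] requested_image[of R, OF assms(1)]
      draw_image[of R, OF assms] integral_map_pmf im mem diff assms(1)
    by (simp add: IH cong: if_cong)
qed

lemma share_equal_prefs:
  assumes "R j = R k"
  shows "share R UNIV UNIV j x = share R UNIV UNIV k x"
proof -
  \<comment> \<open>The transposition of \<open>j\<close> and \<open>k\<close> maps the set of all
    agents to itself.\<close>
  let ?\<sigma> = "id(j := k, k := j)"
  have \<sigma>: "bij ?\<sigma>"
    by (rule involuntory_imp_bij) auto
  have "share R (?\<sigma> ` UNIV) UNIV (?\<sigma> j) x = share R UNIV UNIV j x"
    using assms bij_is_inj[OF \<sigma>] by (intro share_image) auto
  then show ?thesis
    unfolding bij_is_surj[OF \<sigma>] by (cases "j = k") auto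
qed


section \<open>The lexicographic cone\<close>

definition lexpos :: "'b rel \<Rightarrow> ('b \<Rightarrow> real) \<Rightarrow> bool" where
  "lexpos r v \<longleftrightarrow> (\<forall>x. v x = 0) \<or> (\<exists>x. v x > 0 \<and> (\<forall>y. (y, x) \<in> r \<longrightarrow> v y = 0))"

lemma lexpos_zero [simp]: "lexpos r (\<lambda>x. 0)"
  by (simp add: lexpos_def)

lemma lexpos_if: "lexpos r v \<Longrightarrow> lexpos r (\<lambda>x. if b then 0 else v x)"
  by (cases b) simp_all

lemma lexpos_scale: "0 \<le> c \<Longrightarrow> lexpos r v \<Longrightarrow> lexpos r (\<lambda>x. c * v x)"
  unfolding lexpos_def by (metis mult_eq_0_iff mult_pos_pos order_le_less)

text \<open>The better of the two leading positions is the leading position of the sum: there the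
  other vector is still zero, or both are positive.\<close>

lemma lexpos_add:
  assumes r: "strict_linear_order r" and "lexpos r u" and "lexpos r v"
  shows "lexpos r (\<lambda>x. u x + v x)"
proof (cases "(\<forall>x. u x = 0) \<or> (\<forall>x. v x = 0)")
  case True
  then show ?thesis
    using assms(2,3) by (auto simp: lexpos_def)
next
  case False
  then obtain x y where
    x: "u x > 0" "\<And>z. (z, x) \<in> r \<Longrightarrow> u z = 0" and y: "v y > 0" "\<And>z. (z, y) \<in> r \<Longrightarrow> v z = 0"
    using assms(2,3) unfolding lexpos_def by blast
  have tr: "trans r" and tot: "total r"
    using r by (auto simp: strict_linear_order_on_def)
  consider "x = y" | "(x, y) \<in> r" | "(y, x) \<in> r"
    using tot by (auto simp: total_on_def)
  then show ?thesis
  proof cases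
    case 1
    then show ?thesis
      using x y unfolding lexpos_def by (metis add.right_neutral add_pos_pos)
  next
    case 2
    then have "u x + v x > 0 \<and> (\<forall>z. (z, x) \<in> r \<longrightarrow> u z + v z = 0)"
      using x y tr by (metis add.right_neutral transD)
    then show ?thesis
      unfolding lexpos_def by blast
  next
    case 3
    then have "u y + v y > 0 \<and> (\<forall>z. (z, y) \<in> r \<longrightarrow> u z + v z = 0)"
      using x y tr by (metis add.left_neutral add.right_neutral transD)
    then show ?thesis
      unfolding lexpos_def by blast
  qed
qed

lemma lexpos_sum:
  assumes "strict_linear_order r" and "\<And>i. i \<in> I \<Longrightarrow> lexpos r (v i)"
  shows "lexpos r (\<lambda>x. \<Sum>i\<in>I. v i x)"
  using assms(2)
  by (induction I rule: infinite_finite_induct) (auto intro: lexpos_add[OF assms(1)])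

text \<open>An expectation over a finite type is a nonnegative combination, which stays in the
  cone.\<close>

lemma lexpos_expectation:
  fixes p :: "'c::finite pmf"
  assumes "strict_linear_order r" and "\<And>w. w \<in> set_pmf p \<Longrightarrow> lexpos r (v w)"
  shows "lexpos r (\<lambda>x. measure_pmf.expectation p (\<lambda>w. v w x))"
proof -
  have "lexpos r (\<lambda>x. \<Sum>w\<in>set_pmf p. pmf p w * v w x)"
    by (intro lexpos_sum assms lexpos_scale) auto
  also have "(\<lambda>x. \<Sum>w\<in>set_pmf p. pmf p w * v w x) = (\<lambda>x. measure_pmf.expectation p (\<lambda>w. v w x))"
    by (subst integral_measure_pmf_real[of "set_pmf p"]) (auto simp: mult.commute)
  finally show ?thesis .
qed

text \<open>At the leading position \<open>x\<close> of \<open>p - q\<close>, the sums over items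
  better than \<open>x\<close> agree and \<open>p\<close> is larger at \<open>x\<close>, so the
  upper sum at \<open>x\<close> contradicts dominance by \<open>q\<close>.\<close>

lemma sd_ge_lexpos_eq:
  assumes r: "strict_linear_order r" and "sd_ge r q p" and "lexpos r (\<lambda>x. p $ x - q $ x)"
  shows "p = q"
proof (rule ccontr)
  assume "p \<noteq> q"
  then obtain x where x: "p $ x > q $ x" "\<And>y. (y, x) \<in> r \<Longrightarrow> p $ y = q $ y"
    using assms(3) by (auto simp: lexpos_def vec_eq_iff)
  have "(x, x) \<notin> r"
    using r by (auto simp: strict_linear_order_on_def irrefl_def)
  then have "(\<Sum>y\<in>upper_set r x. f $ y) = f $ x + (\<Sum>y\<in>{y. (y, x) \<in> r}. f $ y)" for f :: "real^'a"
    by (simp add: upper_set_def)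
  moreover have "(\<Sum>y\<in>{y. (y, x) \<in> r}. p $ y) = (\<Sum>y\<in>{y. (y, x) \<in> r}. q $ y)"
    using x(2) by (intro sum.cong) auto
  ultimately show False
    using assms(2) x(1) by (auto simp: sd_ge_def dest!: spec[of _ x])
qed

text \<open>Items better than the top of \<open>M\<close> lie outside \<open>M\<close>. This settles
  the round in which two runs diverge.\<close>

lemma lexpos_at_top:
  fixes r :: "('b::finite) rel"
  assumes r: "strict_linear_order r" and "M \<noteq> {}" and "v (top_item r M) > 0"
    and "\<And>x. x \<notin> M \<Longrightarrow> v x = 0"
  shows "lexpos r v"
proof -
  have "y \<notin> M" if "(y, top_item r M) \<in> r" for y
    using that r top_item_in[OF r assms(2)] unfolding strict_linear_order_on_def
    by (metis irrefl_def transD)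
  then show ?thesis
    using assms(3,4) by (auto simp: lexpos_def)
qed

text \<open>Both sides can be conditioned on the same outcome \<open>w\<close>: if \<open>j\<close>
  wins, the difference is 0, and otherwise it is the difference of the next states.\<close>

lemma lexpos_share_step:
  assumes "strict_linear_order r" and "applicants R N M = applicants R' N M"
    and "top_item (R j) M = top_item (R' j) M"
    and "\<And>N'. requested R N M \<noteq> {} \<Longrightarrow> lexpos r (\<lambda>x. share R N' (M - requested R N M) j x
        - share R' N' (M - requested R N M) j x)"
  shows "lexpos r (\<lambda>x. share R N M j x - share R' N M j x)"
proof (cases "requested R N M = {}")
  case False
  let ?Q = "requested R N M"
  have rq: "requested R' N M = requested R N M" and dr: "draw R' N M = draw R N M"
    using assms(2) by (auto simp: requested_def draw_def)
  have "share R N M j x - share R' N M j x = measure_pmf.expectation (draw R N M)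
      (\<lambda>w. if j \<in> w ` ?Q then 0
        else share R (N - w ` ?Q) (M - ?Q) j x - share R' (N - w ` ?Q) (M - ?Q) j x)" for x
    using False assms(3)
    by (subst (1 2) share.simps)
      (auto simp: rq dr simp flip: Bochner_Integration.integral_diff intro!: expectation_draw_cong)
  then show ?thesis
    by (simp only:) (rule lexpos_expectation[OF assms(1)], rule lexpos_if, rule assms(4)[OF False])
next
  case True
  then have "requested R' N M = {}"
    using assms(2) by (simp add: requested_def)
  then show ?thesis
    using True by (simp add: share.simps)
qed


section \<open>Comparing an agent's shares under two profiles\<close>

lemma share_taken:
  assumes "x \<in> requested R N M" and "x \<noteq> top_item (R j) M"
  shows "share R N M j x = 0"
  unfolding share.simps[of R N] using assms
  by (simp add: share_outside cong: if_cong)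

lemma lexpos_misreport:
  fixes R :: "('a::finite, 'b::finite) profile"
  assumes "profile R" and "profile (R(j := r'))"
  shows "lexpos (R j) (\<lambda>x. share R N M j x - share (R(j := r')) N M j x)"
proof (induction N M rule: state_induct[where R = R])
  case (step N M)
  let ?R' = "R(j := r')" and ?t = "top_item (R j) M"
  have r: "strict_linear_order (R j)"
    using assms(1) by (simp add: profile_def)
  consider "j \<notin> N \<or> M = {}" | "?t = top_item r' M"
    | "j \<in> N" "M \<noteq> {}" "?t \<noteq> top_item r' M"
    by blast
  then show ?case
  proof cases
    case 1
    then show ?thesis
      by (auto simp: share_outside)
  next
    case 2
    then have "applicants R N M = applicants ?R' N M" "?t = top_item (?R' j) M"
      by (auto simp: applicants_def fun_eq_iff)
    then show ?thesis
      by (rule lexpos_share_step[OF r _ _ step[OF _ refl]])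
  next
    case 3
    note top = share_top[OF assms(1) 3(1,2)] top_item_requested[OF assms(1) 3(1,2)]
    have "share ?R' N M j ?t < share R N M j ?t"
    \<comment> \<open>A sole applicant wins \<open>?t\<close> for certain, whereas the misreport
      leaves a chance below 1. A rival still requests \<open>?t\<close> under the misreport, so
      \<open>j\<close> loses it.\<close>
    proof (cases "applicants R N M ?t = {j}")
      case True
      then show ?thesis
        using top(1) share_other_lt_1[OF assms(2) 3(1,2)] 3(3) by simp
    next
      case False
      then have "?t \<in> requested ?R' N M"
        using top(2,3) by (auto simp: requested_def applicants_def)
      then have "share ?R' N M j ?t = 0"
        using 3(3) by (intro share_taken) auto
      then show ?thesis
        using top by (auto simp: card_gt_0_iff)
    qed
    then show ?thesis
      by (intro lexpos_at_top[OF r 3(2)]) (simp_all add: share_outside del: fun_upd_apply)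
  qed
qed

lemma lexpos_imitator:
  fixes R :: "('a::finite, 'b::finite) profile"
  assumes "profile R"
  shows "lexpos (R j) (\<lambda>x. share R N M j x - share (R(k := R j)) N M j x)"
proof (induction N M rule: state_induct[where R = R])
  case (step N M)
  let ?R' = "R(k := R j)" and ?t = "top_item (R j) M"
  have r: "strict_linear_order (R j)" and R': "profile ?R'"
    using assms by (auto simp: profile_def)
  consider "j \<notin> N \<or> M = {}" | "k \<notin> N" | "?t = top_item (R k) M"
    | "j \<in> N" "k \<in> N" "M \<noteq> {}" "?t \<noteq> top_item (R k) M"
    by blast
  then show ?case
  proof cases
    case 1
    then show ?thesis
      by (auto simp: share_outside)
  next
    case 2
    then have "share R N M j x = share ?R' N M j x" for x
      \<comment> \<open>The two profiles agree on every agent still present.\<close>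
      by (intro share_cong[where C = UNIV]) auto
    then show ?thesis
      by (simp only: diff_self lexpos_zero)
  next
    case 3
    then have "applicants R N M = applicants ?R' N M" "?t = top_item (?R' j) M"
      by (auto simp: applicants_def fun_eq_iff)
    then show ?thesis
      by (rule lexpos_share_step[OF r _ _ step[OF _ refl]])
  next
    case 4
    have t: "top_item (?R' j) M = ?t"
      by simp
    \<comment> \<open>One more competitor strictly lowers the chance \<open>1 / card\<close> of
      winning \<open>?t\<close>.\<close>
    have "applicants ?R' N M ?t = insert k (applicants R N M ?t)" "k \<notin> applicants R N M ?t"
      using 4 by (auto simp: applicants_def)
    then have "share ?R' N M j ?t < share R N M j ?t"
      using share_top[OF assms 4(1,3)] share_top[OF R' 4(1,3), unfolded t]
        top_item_requested(2)[OF assms 4(1,3)]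
      by (auto simp: card_gt_0_iff intro!: divide_strict_left_mono mult_pos_pos)
    then show ?thesis
      by (intro lexpos_at_top[OF r 4(3)]) (simp_all add: share_outside del: fun_upd_apply)
  qed
qed

lemma lexpos_envy:
  assumes "profile R"
  shows "lexpos (R j) (\<lambda>x. share R UNIV UNIV j x - share R UNIV UNIV k x)"
proof -
  let ?R' = "R(k := R j)"
  \<comment> \<open>The original profile is written as a misreport by \<open>k\<close>, whose true
    preference in \<open>?R'\<close> is that of \<open>j\<close>.\<close>
  have R: "profile ?R'" "profile (?R'(k := R k))" and r: "strict_linear_order (R j)"
    using assms by (auto simp: profile_def)
  have "share ?R' UNIV UNIV j x = share ?R' UNIV UNIV k x" for x
    by (rule share_equal_prefs) simp
  then show ?thesis
    \<comment> \<open>The two summands are the loss of \<open>j\<close> from the imitation and the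
      loss of \<open>k\<close> from returning to \<open>R k\<close>; the shares under
      \<open>?R'\<close> cancel.\<close>
    using lexpos_add[OF r lexpos_imitator[OF assms, of j UNIV UNIV k],
        of "\<lambda>x. share ?R' UNIV UNIV k x - share R UNIV UNIV k x"]
      lexpos_misreport[OF R, of UNIV UNIV] by simp
qed


section \<open>Common prefixes\<close>

lemma top_item_eqI:
  fixes r :: "('b::finite) rel"
  assumes r: "strict_linear_order r" and "x \<in> S" and "\<And>y. y \<in> S \<Longrightarrow> y \<noteq> x \<Longrightarrow> (x, y) \<in> r"
  shows "top_item r S = x"
proof (rule ccontr)
  assume "top_item r S \<noteq> x"
  then have "(x, top_item r S) \<in> r" "(top_item r S, x) \<in> r"
    using top_item_in[OF r, of S] assms(2,3) by (metis empty_iff)+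
  then show False
    using r unfolding strict_linear_order_on_def by (metis irrefl_def transD)
qed

lemma rk_less_iff:
  fixes r :: "('b::finite) rel"
  assumes r: "strict_linear_order r"
  shows "rk r y < rk r z \<longleftrightarrow> (y, z) \<in> r"
proof -
  have tr: "trans r" and ir: "irrefl r" and tot: "total r"
    using r by (auto simp: strict_linear_order_on_def)
  have mono: "rk r a < rk r b" if "(a, b) \<in> r" for a b
  proof -
    have "b \<notin> upper_set r a"
      using that tr ir by (auto simp: upper_set_def irrefl_def dest: transD)
    moreover have "upper_set r a \<subseteq> upper_set r b"
      using that tr by (auto simp: upper_set_def dest: transD)
    ultimately show ?thesis
      unfolding rk_def by (intro psubset_card_mono) (auto simp: upper_set_def)
  qed
  show ?thesis
    using mono[of y z] mono[of z y] tot unfolding total_on_def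
    by (metis UNIV_I less_asym)
qed

text \<open>Ranks are injective and at least 1, so they map \<open>C\<close> onto
  \<open>{1..card C}\<close>; hence \<open>C\<close> is an initial segment of
  \<open>r\<close>.\<close>

lemma rk_prefix_closed:
  fixes r :: "('b::finite) rel"
  assumes r: "strict_linear_order r" and C: "\<And>x. x \<in> C \<Longrightarrow> rk r x \<le> card C"
    and "(y, z) \<in> r" and "z \<in> C"
  shows "y \<in> C"
proof -
  have inj: "inj (rk r)"
    using r by (intro injI) (metis less_irrefl rk_less_iff strict_linear_order_on_def total_on_def UNIV_I)
  have pos: "rk r x \<ge> 1" for x
    by (auto simp: rk_def upper_set_def Suc_le_eq card_gt_0_iff)
  have "rk r ` C = {1..card C}"
    using C pos by (intro card_subset_eq) (auto simp: card_image inj_on_subset[OF inj])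
  moreover have "rk r y \<in> {1..card C}"
    using pos C[OF assms(4)] assms(3) rk_less_iff[OF r, of y z] by auto
  ultimately show ?thesis
    using inj by (metis imageE injD)
qed

text \<open>The prefix is an initial segment of both orders, and equal ranks make them agree on it.
  A set that meets it has its best item there.\<close>

lemma common_prefix_top_item:
  fixes r s :: "('b::finite) rel"
  assumes r: "strict_linear_order r" and s: "strict_linear_order s"
    and C: "common_prefix r s C" and "M \<inter> C \<noteq> {}"
  shows "top_item r M = top_item s M"
proof (cases "r = s")
  case False
  then have rk: "\<And>x. x \<in> C \<Longrightarrow> rk r x = rk s x \<and> rk r x \<le> card C"
    using C by (auto simp: common_prefix_def)
  obtain c where c: "c \<in> M" "c \<in> C"
    using assms(4) by blast
  let ?t = "top_item r M"
  have t: "?t \<in> M" "\<And>y. y \<in> M \<Longrightarrow> y \<noteq> ?t \<Longrightarrow> (?t, y) \<in> r"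
    using top_item_in[OF r] c(1) by auto
  have tC: "?t \<in> C"
    using rk_prefix_closed[OF r, of C ?t c] rk t(2)[OF c(1)] c(2) by metis
  have "(?t, y) \<in> s" if y: "y \<in> M" "y \<noteq> ?t" for y
  proof (cases "y \<in> C")
    case True
    then show ?thesis
      using t(2)[OF y] rk[OF tC] rk[OF True] by (metis r s rk_less_iff)
  next
    case False
    then have "(y, ?t) \<notin> s"
      using rk_prefix_closed[OF s, of C y ?t] rk tC by metis
    then show ?thesis
      using s y(2) by (auto simp: strict_linear_order_on_def total_on_def)
  qed
  then show ?thesis
    using t(1) by (intro top_item_eqI[symmetric] s) auto
qed simp

text \<open>Giving \<open>j\<close> the preference of \<open>k\<close> changes no share of a prefix
  item and makes the two agents interchangeable.\<close>

lemma share_common_prefix: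
  assumes "profile R" and "common_prefix (R j) (R k) C" and "x \<in> C"
  shows "share R UNIV UNIV j x = share R UNIV UNIV k x"
proof -
  let ?R' = "R(j := R k)"
  have top: "top_item (R i) M = top_item (?R' i) M" if "M \<inter> C \<noteq> {}" for M i
    using assms(1,2) that by (auto simp: profile_def intro: common_prefix_top_item)
  have "share R UNIV UNIV i x = share ?R' UNIV UNIV i x" for i
    using top assms(3) by (rule share_cong)
  then show ?thesis
    using share_equal_prefs[of ?R' j k x] by simp
qed


section \<open>Outcomes of the loop\<close>

lemma draw_inj_on:
  assumes "w \<in> set_pmf (draw R N M)"
  shows "inj_on w (requested R N M)"
  using draw_in_applicants[OF assms] unfolding inj_on_def applicants_def
  by (metis (mono_tags, lifting) mem_Collect_eq)

lemma draw_card_diff: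
  assumes "w \<in> set_pmf (draw R N M)" and "card N = card M"
  shows "card (N - w ` requested R N M) = card (M - requested R N M)"
proof -
  have "w ` requested R N M \<subseteq> N"
    using draw_winner(1)[OF assms(1)] by blast
  then show ?thesis
    using assms(2) requested_subset[of R N M]
    by (simp add: card_Diff_subset card_image[OF draw_inj_on[OF assms(1)]])
qed

definition award :: "('b \<Rightarrow> 'a) \<Rightarrow> 'b set \<Rightarrow> ('a \<rightharpoonup> 'b) \<Rightarrow> ('a \<rightharpoonup> 'b)" where
  "award w Q A j = (if j \<in> w ` Q then Some (inv_into Q w j) else A j)"

lemma ebm_loop_step:
  assumes "requested R N M \<noteq> {}"
  shows "ebm_loop R N M A = bind_pmf (draw R N M) (\<lambda>w. ebm_loop R (N - w ` requested R N M)
    (M - requested R N M) (award w (requested R N M) A))"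
  using assms by (subst ebm_loop.simps) (simp add: draw_def award_def[abs_def])

text \<open>Equal cardinalities persist, so the loop ends with no agent and no item left. Each round
  matches its winners bijectively with the requested items, and later rounds leave those winners
  untouched.\<close>

lemma ebm_loop_support:
  assumes "profile R" and "card N = card M" and "B \<in> set_pmf (ebm_loop R N M A)"
  shows "(\<forall>j. j \<notin> N \<longrightarrow> B j = A j) \<and> bij_betw B N (Some ` M)"
  using assms(2,3)
proof (induction N M arbitrary: A rule: state_induct[where R = R])
  case (step N M)
  let ?Q = "requested R N M"
  show ?case
  proof (cases "?Q = {}")
    case True
    then have "M = {}" "N = {}"
      using requested_empty_iff[OF assms(1) step.prems(1)] step.prems(1) by auto
    then show ?thesis
      using step.prems(2) True by (simp add: ebm_loop.simps bij_betw_def)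
  next
    case False
    then obtain w where w: "w \<in> set_pmf (draw R N M)"
      and B: "B \<in> set_pmf (ebm_loop R (N - w ` ?Q) (M - ?Q) (award w ?Q A))"
      using step.prems(2) by (auto simp: ebm_loop_step)
    have W: "w ` ?Q \<subseteq> N"
      using draw_winner(1)[OF w] by blast
    have IH: "B j = award w ?Q A j" if "j \<notin> N - w ` ?Q" for j
      using step.IH[OF False refl draw_card_diff[OF w step.prems(1)] B] that by blast
    have IH2: "bij_betw B (N - w ` ?Q) (Some ` (M - ?Q))"
      using step.IH[OF False refl draw_card_diff[OF w step.prems(1)] B] by blast
    have "bij_betw (Some \<circ> inv_into ?Q w) (w ` ?Q) (Some ` ?Q)"
      using draw_inj_on[OF w]
      by (intro bij_betw_trans[OF bij_betw_inv_into]) (auto simp: bij_betw_def)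
    then have "bij_betw B (w ` ?Q) (Some ` ?Q)"
      by (subst bij_betw_cong[where g = "Some \<circ> inv_into ?Q w"]) (auto simp: IH award_def)
    then have "bij_betw B (w ` ?Q \<union> (N - w ` ?Q)) (Some ` ?Q \<union> Some ` (M - ?Q))"
      using IH2 by (rule bij_betw_combine) auto
    moreover have "w ` ?Q \<union> (N - w ` ?Q) = N" "Some ` ?Q \<union> Some ` (M - ?Q) = Some ` M"
      using W requested_subset[of R N M] by auto
    ultimately show ?thesis
      using IH W by (auto simp: award_def)
  qed
qed

lemma ebm_loop_winner:
  assumes "profile R" and "card N = card M" and w: "w \<in> set_pmf (draw R N M)"
    and "B \<in> set_pmf (ebm_loop R (N - w ` requested R N M) (M - requested R N M)
      (award w (requested R N M) A))"
    and "j \<in> w ` requested R N M"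
  shows "B j = Some (top_item (R j) M)"
proof -
  have "B j = Some (inv_into (requested R N M) w j)"
    using ebm_loop_support[OF assms(1) draw_card_diff[OF w assms(2)] assms(4)] assms(5)
    by (auto simp: award_def)
  then show ?thesis
    using inv_into_f_f[OF draw_inj_on[OF w] draw_winner(2)[OF w assms(5)]]
    by (simp add: draw_winner(3)[OF w assms(5)])
qed

lemma prob_bind_pmf:
  "measure_pmf.prob (bind_pmf p f) X = measure_pmf.expectation p (\<lambda>w. measure_pmf.prob (f w) X)"
  by (simp add: bind_pmf.rep_eq measure_pmf.measure_bind[where N = "count_space UNIV"] measure_subprob)

text \<open>Conditioning on the first draw reproduces the recursion of \<open>share\<close>; equal
  cardinalities ensure that items remain while \<open>j\<close> does.\<close>

lemma prob_ebm_loop: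
  assumes "profile R" and "card N = card M" and "j \<in> N"
  shows "measure_pmf.prob (ebm_loop R N M A) {B. B j = Some x} = share R N M j x"
  using assms(2,3)
proof (induction N M arbitrary: A rule: state_induct[where R = R])
  case (step N M)
  let ?Q = "requested R N M"
  have "M \<noteq> {}"
    using step.prems by auto
  then have Q: "?Q \<noteq> {}"
    using requested_empty_iff[OF assms(1) step.prems(1)] by simp
  show ?case
    unfolding ebm_loop_step[OF Q] prob_bind_pmf share.simps[of R N M] if_not_P[OF Q]
  proof (rule expectation_draw_cong)
    fix w assume w: "w \<in> set_pmf (draw R N M)"
    let ?p = "ebm_loop R (N - w ` ?Q) (M - ?Q) (award w ?Q A)"
    show "measure_pmf.prob ?p {B. B j = Some x} = (if j \<in> w ` ?Q then of_bool (x = top_item (R j) M)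
        else share R (N - w ` ?Q) (M - ?Q) j x)"
    proof (cases "j \<in> w ` ?Q")
      case True
      have "AE B in ?p. B j = Some (top_item (R j) M)"
        using ebm_loop_winner[OF assms(1) step.prems(1) w _ True] by (simp add: AE_measure_pmf_iff)
      then have "measure_pmf.prob ?p {B. B j = Some x}
          = measure_pmf.prob ?p (if x = top_item (R j) M then UNIV else {})"
        by (intro measure_pmf.finite_measure_eq_AE) auto
      then show ?thesis
        using True by simp
    next
      case False
      then show ?thesis
        using step.IH[OF Q refl draw_card_diff[OF w step.prems(1)]] step.prems(2) by simp
    qed
  qed
qed

text \<open>Before round \<open>r\<close> the items left are those outside the earlier sets
  \<open>feri_T\<close>. Then \<open>feri_T R a r\<close> is the set requested in that round, and
  its items go to applicants. The induction advances \<open>r\<close> until it reaches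
  \<open>s\<close>.\<close>

lemma ebm_loop_feri:
  assumes "profile R" and "bij a"
    and "card N = card M" and "B \<in> set_pmf (ebm_loop R N M A)" and "\<And>j. j \<in> N \<Longrightarrow> B j = Some (a j)"
    and "1 \<le> r" and "UNIV - (\<Union>r'\<in>{1..<r}. feri_T R a r') = M"
    and "r \<le> s" and "x \<in> feri_T R a s"
  shows "x = top_item (R (inv a x)) (UNIV - (\<Union>r'\<in>{1..<s}. feri_T R a r'))"
  using assms(3-)
proof (induction N M arbitrary: A r rule: state_induct[where R = R])
  case (step N M)
  let ?Q = "requested R N M" and ?U = "\<lambda>r. \<Union>r'\<in>{1..<r}. feri_T R a r'"
  have "Some ` a ` N = Some ` M"
    using ebm_loop_support[OF assms(1) step.prems(1,2)] step.prems(3)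
    by (auto simp: bij_betw_def image_image)
  then have aN: "a ` N = M"
    by (simp add: inj_image_eq_iff)
  have mem: "a j \<in> M \<longleftrightarrow> j \<in> N" for j
    using aN assms(2) by (auto simp: bij_def inj_image_mem_iff simp flip: aN)
  \<comment> \<open>Membership of \<open>x\<close> in the set at \<open>s\<close> provides an agent
    not served before, so the loop cannot have stopped yet.\<close>
  obtain i where i: "a i \<notin> ?U s"
    using step.prems(7) by (subst (asm) feri_T.simps) auto
  have "?U r \<subseteq> ?U s"
    using step.prems(6) by (intro UN_mono) auto
  then have "a i \<in> M"
    using i step.prems(5) by auto
  then have Q: "?Q \<noteq> {}"
    using requested_empty_iff[OF assms(1) step.prems(1)] by auto
  then obtain w where w: "w \<in> set_pmf (draw R N M)"
    and B: "B \<in> set_pmf (ebm_loop R (N - w ` ?Q) (M - ?Q) (award w ?Q A))"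
    using step.prems(2) by (auto simp: ebm_loop_step)
  have compl: "a j \<notin> ?U r \<longleftrightarrow> j \<in> N" for j
    using mem step.prems(5) by auto
  have "feri_T R a r = {x. \<exists>j. j \<in> N \<and> x = top_item (R j) M}"
    by (subst feri_T.simps) (simp only: compl step.prems(5))
  also have "\<dots> = ?Q"
    using top_item_requested(1)[OF assms(1)] \<open>a i \<in> M\<close>
    by (auto simp: requested_def applicants_def)
  finally have T: "feri_T R a r = ?Q" .
  show ?case
  proof (cases "s = r")
    case True
    then have x: "x \<in> ?Q"
      using step.prems(7) T by simp
    have wx: "w x \<in> N" "top_item (R (w x)) M = x"
      using draw_in_applicants[OF w x] by (auto simp: applicants_def)
    then have "a (w x) = x"
      using ebm_loop_winner[OF assms(1) step.prems(1) w B, of "w x"] step.prems(3)[OF wx(1)] x by simp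
    then have "inv a x = w x"
      using assms(2) by (metis bij_inv_eq_iff)
    then show ?thesis
      using wx(2) True step.prems(5) by simp
  next
    case False
    have "{1..<Suc r} = insert r {1..<r}"
      using step.prems(4) by auto
    then have "UNIV - ?U (Suc r) = M - ?Q"
      using step.prems(5) T by auto
    then show ?thesis
      using step.prems(3,6,7) False
      by (intro step.IH[OF Q refl draw_card_diff[OF w step.prems(1)] B, of "Suc r"]) auto
  qed
qed


section \<open>The expected assignment\<close>

lemma EBM_support:
  fixes R :: "('a::finite, 'b::finite) profile"
  assumes "CARD('a) = CARD('b)" and "profile R" and "a \<in> set_pmf (EBM R)"
  shows "bij a" and "FERI R a"
proof -
  obtain B where B: "B \<in> set_pmf (ebm_loop R UNIV UNIV Map.empty)" and a: "a = (\<lambda>j. the (B j))"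
    using assms(3) by (auto simp: EBM_def)
  have bij: "bij_betw B UNIV (range Some)"
    using ebm_loop_support[OF assms(2,1) B] by blast
  then have "B j \<in> range Some" for j
    by (auto simp: bij_betw_def)
  then have Ba: "B j = Some (a j)" for j
    unfolding a by (metis imageE option.sel)
  have "bij_betw (Some \<circ> a) UNIV (range Some)"
    using bij Ba by (simp add: comp_def flip: Ba)
  then show "bij a"
    by (subst (asm) bij_betw_comp_iff2[symmetric, of Some UNIV]) (auto simp: bij_betw_def)
  \<comment> \<open>The start is \<open>r = 1\<close>, where the union of earlier sets is
    empty.\<close>
  then show "FERI R a"
    unfolding FERI_def
    by (intro allI impI ballI ebm_loop_feri[OF assms(2) _ assms(1) B, of a 1]) (auto simp: Ba)
qed

lemma expected_EBM_share:
  fixes R :: "('a::finite, 'b::finite) profile"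
  assumes "CARD('a) = CARD('b)" and "profile R"
  shows "expected_EBM R $ j $ x = share R UNIV UNIV j x"
proof -
  let ?p = "ebm_loop R UNIV UNIV Map.empty"
  have "B j \<noteq> None" if "B \<in> set_pmf ?p" for B
    using ebm_loop_support[OF assms(2,1) that] unfolding bij_betw_def
    by (metis UNIV_I imageE imageI option.distinct(1))
  then have "measure_pmf.prob ?p {B. the (B j) = x} = measure_pmf.prob ?p {B. B j = Some x}"
    by (intro measure_pmf.finite_measure_eq_AE) (auto simp: AE_measure_pmf_iff)
  then show ?thesis
    using prob_ebm_loop[OF assms(2,1), of j Map.empty x]
    by (simp add: expected_EBM_def EBM_def vimage_def)
qed

text \<open>This exhibits the expected matrix as a convex combination of the possible
  outcomes.\<close>

lemma expected_EBM_sum: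
  "expected_EBM R = (\<Sum>a\<in>set_pmf (EBM R). pmf (EBM R) a *\<^sub>R perm_matrix a)"
proof -
  have "measure_pmf.prob (EBM R) {a. a j = x}
      = (\<Sum>a\<in>set_pmf (EBM R). pmf (EBM R) a * (if a j = x then 1 else 0))" for j x
  proof -
    have "measure_pmf.prob (EBM R) {a. a j = x}
        = measure_pmf.expectation (EBM R) (indicator {a. a j = x})"
      by simp
    also have "\<dots> = (\<Sum>a\<in>set_pmf (EBM R). pmf (EBM R) a * (if a j = x then 1 else 0))"
      by (subst integral_measure_pmf_real[of "set_pmf (EBM R)"], simp, simp, intro sum.cong) auto
    finally show ?thesis .
  qed
  then show ?thesis
    by (simp add: vec_eq_iff expected_EBM_def perm_matrix_def)
qed

lemma expected_EBM_ep_FERI: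
  fixes R :: "('a::finite, 'b::finite) profile"
  assumes "CARD('a) = CARD('b)" and "profile R"
  shows "ep_FERI R (expected_EBM R)"
  unfolding ep_FERI_def expected_EBM_sum
  using EBM_support[OF assms]
  by (intro convex_sum convex_convex_hull hull_inc sum_pmf_eq_1) auto

section \<open>Convex combinations of permutation matrices are doubly stochastic\<close>

lemma convex_random_assignment: "convex {P. random_assignment P}"
  unfolding convex_def random_assignment_def
  by (auto simp: sum.distrib simp flip: sum_distrib_left)

lemma random_assignment_perm_matrix:
  assumes "bij a"
  shows "random_assignment (perm_matrix a)"
proof -
  have "a j = x \<longleftrightarrow> j = inv a x" for j x
    using assms by (metis bij_inv_eq_iff)
  then have "(\<Sum>j\<in>UNIV. if a j = x then 1 else 0 :: real) = 1" for x
    by (simp only: sum.delta finite UNIV_I if_True)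
  then show ?thesis
    by (simp add: random_assignment_def perm_matrix_def)
qed

lemma ep_FERI_random_assignment: "ep_FERI R P \<Longrightarrow> random_assignment P"
  unfolding ep_FERI_def
  using hull_minimal[of "{perm_matrix a |a. bij a \<and> FERI R a}" "{P. random_assignment P}" convex]
    convex_random_assignment random_assignment_perm_matrix by blast

theorem theorem1:
  fixes f :: "('a::finite, 'b::finite) mechanism"
  assumes "CARD('a) = CARD('b)"
    and "f = expected_EBM"
  shows "mechanism f \<and> satisfies f ep_FERI \<and> satisfies f sd_WEF \<and> satisfies f SETE \<and> sd_WSP f"
proof (intro conjI)
  note share = expected_EBM_share[OF assms(1)]
  show ep: "satisfies f ep_FERI"
    using expected_EBM_ep_FERI[OF assms(1)] by (simp add: satisfies_def assms(2))
  then show "mechanism f"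
    by (auto simp: mechanism_def satisfies_def intro: ep_FERI_random_assignment)
  show "satisfies f SETE"
    by (auto simp: satisfies_def SETE_def assms(2) share intro: share_common_prefix)
  show "satisfies f sd_WEF"
    unfolding satisfies_def sd_WEF_def assms(2)
  proof (intro allI impI)
    fix R :: "('a, 'b) profile" and j k
    assume R: "profile R" and "sd_ge (R j) (expected_EBM R $ k) (expected_EBM R $ j)"
    then show "expected_EBM R $ j = expected_EBM R $ k"
      by (rule_tac sd_ge_lexpos_eq) (auto simp: profile_def share lexpos_envy)
  qed
  show "sd_WSP f"
    unfolding sd_WSP_def assms(2)
  proof (intro allI impI)
    fix R :: "('a, 'b) profile" and j r'
    assume R: "profile R" "profile (R(j := r'))"
      and "sd_ge (R j) (expected_EBM (R(j := r')) $ j) (expected_EBM R $ j)"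
    then have "expected_EBM R $ j = expected_EBM (R(j := r')) $ j"
      using lexpos_misreport[OF R]
      by (rule_tac sd_ge_lexpos_eq) (auto simp: profile_def share)
    then show "expected_EBM (R(j := r')) $ j = expected_EBM R $ j"
      by simp
  qed
qed

end
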